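(* Let $q\in[0,2]$, let $M>1$ be a constant, and let $\beta=\beta_n\in\mathbb R$ and $\sigma=\sigma_n>0$ be given. For all sufficiently large $n$ there exists a model (an array $(\mu_{kl})_{k,l\in[n]}$ and a noise distribution for $(Z_{ij})_{1\le i\ne j\le n}$) satisfying the noise condition (N), the signal condition (S) and the upper signal condition (U), such that, for some constant $c>0$ independent of $n$ and some sequence $\eta_n\to0$, for all sufficiently large $n$, $$\inf_{\hat r}\sup_{r\in\mathcal R}\mathbb E_r\,\ell_q(\hat r,r)\ge c\begin{cases}\exp\left(-(1+\eta_n)s_n\right), & s_n>1,\\[2pt] s_n^{-q/2}\wedge n^q, & s_n\le 1,\end{cases}\qquad\text{where } s_n=\frac{n\beta^2}{4\sigma^2},$$ and the infimum is over all estimators $\hat r$, i.e. measurable functions of $\{X_{ij}\}_{1\le i\ne j\le n}$ with values in $[n]^n$. (If $\beta=0$, the bound in the second case is read as $n^q$.)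
   Context: Write $[n]=\{1,\dots,n\}$, $a\wedge b=\min(a,b)$, and let $\|\cdot\|$ be the Euclidean norm on $\mathbb R^n$. Asymptotics are as $n\to\infty$. Rank space: $\mathcal R=\{r=(r(1),\dots,r(n))\in[n]^n:\ |\sum_{i=1}^n r(i)-\sum_{i=1}^n i|\le c_n\}$, where $c_n$ is a given sequence with $1\le c_n=o(\sqrt n)$. Model: for a real array $(\mu_{kl})_{k,l\in[n]}$ and $r\in\mathcal R$, $\mathbb P_r$ (with expectation $\mathbb E_r$) is the law of the observations $\{X_{ij}\}_{1\le i\ne j\le n}$, $X_{ij}=\mu_{r(i)r(j)}+Z_{ij}$. (N) Noise condition: for every $t>0$ and all reals $(v_{ij})_{1\le i\neq j\le n}$ with $\sum_{i\ne j}v_{ij}^2=1$, $\mathbb P(\sum_{1\le i\ne j\le n}v_{ij}Z_{ij}>t)\le\exp(-t^2/(2\sigma^2))$. (S) Signal condition: for all $r,\tilde r\in\mathcal R$, $\sum_{1\le i\ne j\le n}(\mu_{\tilde r(i)\tilde r(j)}-\mu_{r(i)r(j)})^2\ge 2n\beta^2\|\tilde r-r\|^2$. (U) Upper signal condition: for all $r,\tilde r\in\mathcal R$, $\sum_{1\le i\ne j\le n}(\mu_{\tilde r(i)\tilde r(j)}-\mu_{r(i)r(j)})^2\le 2Mn\beta^2\|\tilde r-r\|^2$. Loss: $\ell_0(\hat r,r)=\frac1n\sum_{i=1}^n\mathbb I\{\hat r(i)\ne r(i)\}$, and $\ell_q(\hat r,r)=\frac1n\sum_{i=1}^n|\hat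 r(i)-r(i)|^q$ for $q\in(0,2]$. *)

theory Defs
  imports "HOL-Probability.Probability" "HOL-Library.Landau_Symbols"
begin

definition offdiag :: "nat \<Rightarrow> (nat \<times> nat) set" where
  "offdiag n = {(i, j). i \<in> {1..n} \<and> j \<in> {1..n} \<and> i \<noteq> j}"

abbreviation grid :: "nat \<Rightarrow> (nat \<Rightarrow> nat) set" where
  "grid n \<equiv> {1..n} \<rightarrow>\<^sub>E {1..n}"

text \<open>The parameter \<open>b\<close> is the value \<open>c\<^sub>n\<close> of the given sequence.\<close>
definition rank_space :: "nat \<Rightarrow> real \<Rightarrow> (nat \<Rightarrow> nat) set" where
  "rank_space n b =
     {r \<in> grid n. \<bar>(\<Sum>i=1..n. real (r i)) - (\<Sum>i=1..n. real i)\<bar> \<le> b}"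

abbreviation array_space :: "nat \<Rightarrow> (nat \<times> nat \<Rightarrow> real) measure" where
  "array_space n \<equiv> Pi\<^sub>M (offdiag n) (\<lambda>_. borel)"

text \<open>\<open>N\<close> is the joint law of the noise array; its entries need not be independent.\<close>
definition noise_law :: "nat \<Rightarrow> (nat \<times> nat \<Rightarrow> real) measure \<Rightarrow> bool" where
  "noise_law n N \<longleftrightarrow> prob_space N \<and> sets N = sets (array_space n)"

definition noise_condition ::
    "nat \<Rightarrow> real \<Rightarrow> (nat \<times> nat \<Rightarrow> real) measure \<Rightarrow> bool" where
  "noise_condition n \<sigma> N \<longleftrightarrow>
     (\<forall>t>0. \<forall>v :: nat \<times> nat \<Rightarrow> real. (\<Sum>p\<in>offdiag n. (v p)\<^sup>2) = 1 \<longrightarrow>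
        measure N {z \<in> space N. (\<Sum>p\<in>offdiag n. v p * z p) > t} \<le> exp (- t\<^sup>2 / (2 * \<sigma>\<^sup>2)))"

definition signal_diff ::
    "nat \<Rightarrow> (nat \<Rightarrow> nat \<Rightarrow> real) \<Rightarrow> (nat \<Rightarrow> nat) \<Rightarrow> (nat \<Rightarrow> nat) \<Rightarrow> real" where
  "signal_diff n \<mu> r' r = (\<Sum>(i, j)\<in>offdiag n. (\<mu> (r' i) (r' j) - \<mu> (r i) (r j))\<^sup>2)"

definition rank_dist :: "nat \<Rightarrow> (nat \<Rightarrow> nat) \<Rightarrow> (nat \<Rightarrow> nat) \<Rightarrow> real" where
  "rank_dist n r' r = L2_set (\<lambda>i. real (r' i) - real (r i)) {1..n}"

definition signal_condition ::
    "nat \<Rightarrow> real \<Rightarrow> real \<Rightarrow> (nat \<Rightarrow> nat \<Rightarrow> real) \<Rightarrow> bool" where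
  "signal_condition n b \<beta> \<mu> \<longleftrightarrow>
     (\<forall>r\<in>rank_space n b. \<forall>r'\<in>rank_space n b.
        signal_diff n \<mu> r' r \<ge> 2 * real n * \<beta>\<^sup>2 * (rank_dist n r' r)\<^sup>2)"

definition upper_signal_condition ::
    "nat \<Rightarrow> real \<Rightarrow> real \<Rightarrow> real \<Rightarrow> (nat \<Rightarrow> nat \<Rightarrow> real) \<Rightarrow> bool" where
  "upper_signal_condition n b M \<beta> \<mu> \<longleftrightarrow>
     (\<forall>r\<in>rank_space n b. \<forall>r'\<in>rank_space n b.
        signal_diff n \<mu> r' r \<le> 2 * M * real n * \<beta>\<^sup>2 * (rank_dist n r' r)\<^sup>2)"

definition obs_law ::
    "nat \<Rightarrow> (nat \<Rightarrow> nat \<Rightarrow> real) \<Rightarrow> (nat \<times> nat \<Rightarrow> real) measure \<Rightarrow> (nat \<Rightarrow> nat) \<Rightarrow>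
     (nat \<times> nat \<Rightarrow> real) measure" where
  "obs_law n \<mu> N r =
     distr N (array_space n) (\<lambda>z. \<lambda>(i, j)\<in>offdiag n. \<mu> (r i) (r j) + z (i, j))"

definition loss :: "nat \<Rightarrow> real \<Rightarrow> (nat \<Rightarrow> nat) \<Rightarrow> (nat \<Rightarrow> nat) \<Rightarrow> real" where
  "loss n q r' r =
     (if q = 0 then (\<Sum>i=1..n. of_bool (r' i \<noteq> r i)) / real n
      else (\<Sum>i=1..n. \<bar>real (r' i) - real (r i)\<bar> powr q) / real n)"

abbreviation estimators :: "nat \<Rightarrow> ((nat \<times> nat \<Rightarrow> real) \<Rightarrow> (nat \<Rightarrow> nat)) set" where
  "estimators n \<equiv> array_space n \<rightarrow>\<^sub>M count_space (grid n)"

text \<open>For \<open>n \<ge> 1\<close> and \<open>b \<ge> 0\<close> the rank space contains the identity ranking, there are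
  constant estimators, and \<open>0 \<le> loss \<le> n\<^sup>2\<close> for \<open>q \<in> [0, 2]\<close>; so the infimum and the
  supremum below are taken over nonempty bounded sets of reals.\<close>
definition minimax_risk ::
    "nat \<Rightarrow> real \<Rightarrow> real \<Rightarrow> (nat \<Rightarrow> nat \<Rightarrow> real) \<Rightarrow> (nat \<times> nat \<Rightarrow> real) measure \<Rightarrow> real" where
  "minimax_risk n b q \<mu> N =
     (INF est\<in>estimators n. SUP r\<in>rank_space n b.
        integral\<^sup>L (obs_law n \<mu> N r) (\<lambda>x. loss n q (est x) r))"

definition snr :: "nat \<Rightarrow> real \<Rightarrow> real \<Rightarrow> real" where
  "snr n \<beta> \<sigma> = real n * \<beta>\<^sup>2 / (4 * \<sigma>\<^sup>2)"

text \<open>Since \<open>0 powr a = 0\<close> in HOL, the case \<open>s = 0\<close> (that is, \<open>\<beta> = 0\<close>), where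
  \<open>s powr (- q / 2)\<close> does not have its intended value, is separated; there the rate is
  \<open>n powr q\<close>.\<close>
definition rate :: "nat \<Rightarrow> real \<Rightarrow> real \<Rightarrow> real \<Rightarrow> real" where
  "rate n q \<eta> s =
     (if s > 1 then exp (- (1 + \<eta>) * s)
      else if s = 0 then real n powr q
      else min (s powr (- q / 2)) (real n powr q))"

end

theory Submission
  imports Defs
begin

text \<open>
  Both the array and the noise may be chosen, and both are taken constant along rows:
  \<open>\<mu> k l = \<alpha> * k\<close> and \<open>Z\<^sub>i\<^sub>j = a * w\<^sub>i\<close> with independent symmetric \<open>w\<^sub>i \<in> {-1, 0, 1}\<close>.
  The signal difference of two rankings is then exactly \<open>\<alpha>\<^sup>2 (n - 1)\<close> times their squared
  distance, so \<open>\<alpha>\<^sup>2 (n - 1) = 2 n \<beta>\<^sup>2\<close> turns the signal condition into an equality, and the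
  upper signal condition follows from \<open>M \<ge> 1\<close>.  What remains is to locate \<open>\<alpha> r(i)\<close> from
  \<open>\<alpha> r(i) + a w\<^sub>i\<close>, separately for each \<open>i\<close>.

  Fix \<open>k \<ge> 1\<close> and let \<open>a = \<alpha> k / 2\<close>.  The true ranks \<open>x\<close> and \<open>x + k\<close> produce the same observation
  when \<open>w\<^sub>i = 1\<close> in the first case and \<open>w\<^sub>i = -1\<close> in the second, and these two events have the
  same probability \<open>p\<close> (lemma \<open>two_point_bound\<close>).  Every estimator therefore loses at least
  \<open>p (k/2)\<^sup>q\<close> on one of the two, up to the factor 1/2.  For \<open>\<tau>\<^sup>2 = \<sigma>\<^sup>2 / (n - 1)\<close>, the atoms
  \<open>\<plusminus>a\<close> may carry the mass \<open>p = exp (- a\<^sup>2 / (2 \<tau>\<^sup>2)) / 8 = exp (- k\<^sup>2 s) / 8\<close> without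
  violating the moment bound \<open>E exp (y a w\<^sub>i) \<le> exp (y\<^sup>2 \<tau>\<^sup>2 / 2)\<close> (lemma \<open>three_point_mgf\<close>),
  from which the noise condition follows by Chernoff's bound and the Cauchy-Schwarz inequality.
  With Gaussian noise the overlap of the two laws would be smaller by a further factor of order
  \<open>1 / sqrt s\<close> for large \<open>s\<close>; with these atoms the bound holds with \<open>\<eta> = 0\<close>.

  The ranks cannot be perturbed freely, since a ranking in the rank space has an almost
  prescribed sum.  Let \<open>h = n div 2\<close>.  Averaging over a family of perturbed rankings in which each
  member has a neighbour in the family for at least \<open>h\<close> of the coordinates \<open>i\<close> (lemmas \<open>averaging_bound\<close> and
  \<open>minimax_risk_lower_bound\<close>) avoids this obstacle:
  \<^item> If \<open>s > 1\<close>, take \<open>k = 1\<close> and raise either \<open>h\<close> or \<open>h + 1\<close> of \<open>2 h\<close> ranks by one.  The sum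
    varies by one only, and neighbours differ in a single rank, so the cost is \<open>p\<close>, of order
    \<open>exp (- s)\<close>.
  \<^item> If \<open>s \<le> 1\<close>, take \<open>k\<close> of order \<open>min (1 / sqrt s) n\<close> and raise exactly one rank of each of
    \<open>h\<close> disjoint pairs by \<open>k\<close>.  The sum is constant, and neighbours differ in two ranks, so the
    cost is \<open>p\<^sup>2\<close>, which is bounded below because \<open>k\<^sup>2 s \<le> 1\<close>.
\<close>

section \<open>A signal that depends on the row only\<close>

lemma sum_offdiag:
  "(\<Sum>p\<in>offdiag n. f p) = (\<Sum>i=1..n. \<Sum>j\<in>{1..n} - {i}. f (i, j))"
proof -
  have "offdiag n = Sigma {1..n} (\<lambda>i. {1..n} - {i})"
    by (auto simp: offdiag_def)
  then show ?thesis
    by (simp add: sum.Sigma)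
qed

lemma finite_rank_space: "finite (rank_space n b)"
  by (rule finite_subset[of _ "grid n"]) (auto simp: rank_space_def intro!: finite_PiE)

lemma signal_diff_row:
  assumes "n \<ge> 1"
  shows "signal_diff n (\<lambda>k l. \<alpha> * real k) r' r = \<alpha>\<^sup>2 * (real n - 1) * (rank_dist n r' r)\<^sup>2"
proof -
  have "signal_diff n (\<lambda>k l. \<alpha> * real k) r' r
      = (\<Sum>i=1..n. \<Sum>j\<in>{1..n} - {i}. (\<alpha> * real (r' i) - \<alpha> * real (r i))\<^sup>2)"
    unfolding signal_diff_def sum_offdiag by simp
  also have "\<dots> = (\<Sum>i=1..n. \<alpha>\<^sup>2 * (real n - 1) * (real (r' i) - real (r i))\<^sup>2)"
  proof (rule sum.cong)
    fix i assume i: "i \<in> {1..n}"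
    have "(\<alpha> * real (r' i) - \<alpha> * real (r i))\<^sup>2 = \<alpha>\<^sup>2 * (real (r' i) - real (r i))\<^sup>2"
      by (simp add: right_diff_distrib[symmetric] power_mult_distrib)
    then show "(\<Sum>j\<in>{1..n} - {i}. (\<alpha> * real (r' i) - \<alpha> * real (r i))\<^sup>2)
        = \<alpha>\<^sup>2 * (real n - 1) * (real (r' i) - real (r i))\<^sup>2"
      using i assms by (simp add: of_nat_diff)
  qed simp
  also have "\<dots> = \<alpha>\<^sup>2 * (real n - 1) * (rank_dist n r' r)\<^sup>2"
    by (simp add: rank_dist_def L2_set_def sum_nonneg sum_distrib_left)
  finally show ?thesis .
qed

section \<open>Symmetric coins with three values\<close>

text \<open>The law on \<open>{-1, 0, 1}\<close> with mass \<open>p\<close> at each of \<open>-1\<close> and \<open>1\<close>; meaningful for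
  \<open>0 \<le> p \<le> 1 / 2\<close>.\<close>
definition three_point_pmf :: "real \<Rightarrow> int pmf" where
  "three_point_pmf p = pmf_of_list [(-1, p), (0, 1 - 2 * p), (1, p)]"

context
  fixes p :: real
  assumes p: "0 \<le> p" "p \<le> 1 / 2"
begin

lemma three_point_wf: "pmf_of_list_wf [(-1 :: int, p), (0, 1 - 2 * p), (1, p)]"
  using p by (intro pmf_of_list_wfI) auto

lemma pmf_three_point:
  "pmf (three_point_pmf p) x = (if x = -1 \<or> x = 1 then p else if x = 0 then 1 - 2 * p else 0)"
  unfolding three_point_pmf_def by (subst pmf_pmf_of_list[OF three_point_wf]) auto

lemma set_three_point: "set_pmf (three_point_pmf p) \<subseteq> {-1, 0, 1}"
  unfolding three_point_pmf_def using set_pmf_of_list[OF three_point_wf] by simp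

lemma expectation_three_point:
  "measure_pmf.expectation (three_point_pmf p) f = p * f (-1) + (1 - 2 * p) * f 0 + p * f 1"
  for f :: "int \<Rightarrow> real"
  by (subst integral_measure_pmf_real[of "{-1, 0, 1}"])
     (use set_three_point in \<open>auto simp: pmf_three_point algebra_simps\<close>)

end

text \<open>Independent coins \<open>w 1, \<dots>, w n\<close>; outside \<open>{1..n}\<close> the value is 0.\<close>
definition coins :: "nat \<Rightarrow> real \<Rightarrow> (nat \<Rightarrow> int) pmf" where
  "coins n p = Pi_pmf {1..n} 0 (\<lambda>_. three_point_pmf p)"

lemma finite_set_coins:
  assumes "0 \<le> p" "p \<le> 1 / 2"
  shows "finite (set_pmf (coins n p))"
proof (rule finite_subset)
  show "set_pmf (coins n p) \<subseteq> PiE_dflt {1..n} 0 (\<lambda>_. set_pmf (three_point_pmf p))"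
    unfolding coins_def using set_Pi_pmf_subset'[of "{1..n}" 0 "\<lambda>_. three_point_pmf p"]
    by (simp add: comp_def)
  have "finite (set_pmf (three_point_pmf p))"
    using set_three_point[OF assms] by (rule finite_subset) simp
  then show "finite (PiE_dflt {1..n} 0 (\<lambda>_. set_pmf (three_point_pmf p)))"
    by (intro finite_PiE_dflt) auto
qed

lemma prob_coins_fixed:
  assumes p: "0 \<le> p" "p \<le> 1 / 2" and D: "D \<subseteq> {1..n}" and s: "\<And>i. i \<in> D \<Longrightarrow> s i \<in> {-1, 1}"
  shows "measure_pmf.prob (coins n p) {w. \<forall>i\<in>D. w i = s i} = p ^ card D"
proof -
  have "{w. \<forall>i\<in>D. w i = s i} = Pi {1..n} (\<lambda>i. if i \<in> D then {s i} else UNIV)"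
    using D by (auto simp: Pi_def split: if_splits)
  then have "measure_pmf.prob (coins n p) {w. \<forall>i\<in>D. w i = s i}
      = (\<Prod>i\<in>{1..n}. measure_pmf.prob (three_point_pmf p) (if i \<in> D then {s i} else UNIV))"
    unfolding coins_def by (simp add: measure_Pi_pmf_Pi)
  also have "\<dots> = (\<Prod>i\<in>{1..n}. if i \<in> D then p else 1)"
    using s by (intro prod.cong) (auto simp: measure_pmf_single pmf_three_point[OF p])
  also have "\<dots> = p ^ card D"
    using D by (simp add: prod.If_cases Int_absorb1)
  finally show ?thesis .
qed

text \<open>The involution that changes the sign of the coins in \<open>D\<close>; it preserves the law of the
  coins.\<close>
definition flip_signs :: "nat set \<Rightarrow> (nat \<Rightarrow> int) \<Rightarrow> nat \<Rightarrow> int" where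
  "flip_signs D w = (\<lambda>i. if i \<in> D then - w i else w i)"

lemma map_flip_signs_coins:
  assumes p: "0 \<le> p" "p \<le> 1 / 2"
  shows "map_pmf (flip_signs D) (coins n p) = coins n p"
proof (rule pmf_eqI)
  fix w
  have inv: "flip_signs D (flip_signs D v) = v" for v
    by (auto simp: flip_signs_def)
  then have "inj (flip_signs D)"
    by (metis injI)
  then have "pmf (map_pmf (flip_signs D) (coins n p)) w = pmf (coins n p) (flip_signs D w)"
    by (metis inv pmf_map_inj')
  also have "\<dots> = pmf (coins n p) w"
  proof -
    have "pmf (three_point_pmf p) (flip_signs D w i) = pmf (three_point_pmf p) (w i)" for i
      by (auto simp: flip_signs_def pmf_three_point[OF p])
    moreover have "flip_signs D w i = 0 \<longleftrightarrow> w i = 0" for i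
      by (simp add: flip_signs_def)
    ultimately show ?thesis
      unfolding coins_def by (subst (1 2) pmf_Pi) auto
  qed
  finally show "pmf (map_pmf (flip_signs D) (coins n p)) w = pmf (coins n p) w" .
qed

section \<open>Two confusable rankings\<close>

text \<open>The array of observations for the ranking \<open>r\<close> and the coins \<open>w\<close>.  With \<open>\<alpha> = 0\<close> it is the
  array of the noise.\<close>
definition observe :: "nat \<Rightarrow> real \<Rightarrow> real \<Rightarrow> (nat \<Rightarrow> nat) \<Rightarrow> (nat \<Rightarrow> int) \<Rightarrow> nat \<times> nat \<Rightarrow> real" where
  "observe n \<alpha> a r w = (\<lambda>(i, j)\<in>offdiag n. \<alpha> * real (r i) + a * of_int (w i))"

text \<open>Let \<open>r\<close> and \<open>r'\<close> differ exactly on \<open>D\<close>, by \<open>\<plusminus>k\<close> with sign \<open>s\<close>.  On the event that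
  \<open>w i = s i\<close> for all \<open>i \<in> D\<close>, the observation under \<open>r\<close> coincides with the one under \<open>r'\<close> with
  the coins in \<open>D\<close> flipped.  Nonnegative losses \<open>f\<close> and \<open>f'\<close> that cannot both be small at the
  same observation thus have a large total expectation.\<close>
lemma two_point_bound:
  fixes f f' :: "(nat \<times> nat \<Rightarrow> real) \<Rightarrow> real"
  assumes p: "0 \<le> p" "p \<le> 1 / 2" and D: "D \<subseteq> {1..n}"
    and s: "\<And>i. i \<in> D \<Longrightarrow> s i \<in> {-1, 1}"
    and diff: "\<And>i. i \<in> {1..n} \<Longrightarrow> real (r' i) - real (r i) = (if i \<in> D then k * of_int (s i) else 0)"
    and a: "a = \<alpha> * k / 2"
    and nonneg: "\<And>x. f x \<ge> 0" "\<And>x. f' x \<ge> 0"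
    and sep: "\<And>x. f x + f' x \<ge> \<delta>"
  shows "p ^ card D * \<delta> \<le> measure_pmf.expectation (coins n p) (\<lambda>w. f (observe n \<alpha> a r w))
           + measure_pmf.expectation (coins n p) (\<lambda>w. f' (observe n \<alpha> a r' w))"
proof -
  let ?P = "coins n p" and ?S = "{w. \<forall>i\<in>D. w i = s i}"
  have integrable: "integrable (measure_pmf ?P) g" for g :: "_ \<Rightarrow> real"
    by (rule integrable_measure_pmf_finite[OF finite_set_coins[OF p]])
  have confused: "observe n \<alpha> a r w = observe n \<alpha> a r' (flip_signs D w)" if "w \<in> ?S" for w
  proof -
    have "\<alpha> * real (r i) + a * of_int (w i) = \<alpha> * real (r' i) + a * of_int (flip_signs D w i)"
      if i: "i \<in> {1..n}" for i
    proof -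
      have "real (r' i) = real (r i) + (if i \<in> D then k * of_int (s i) else 0)"
        using diff[OF i] by simp
      then show ?thesis
        using \<open>w \<in> ?S\<close> by (auto simp: flip_signs_def a algebra_simps)
    qed
    then show ?thesis
      unfolding observe_def by (intro restrict_ext) (auto simp: offdiag_def)
  qed
  have "p ^ card D * \<delta> = measure_pmf.expectation ?P (\<lambda>w. indicator ?S w * \<delta>)"
    using prob_coins_fixed[OF p D s] by simp
  \<comment> \<open>The second expectation is computed with flipped coins, which have the same law.\<close>
  also have "\<dots> \<le> measure_pmf.expectation ?P
      (\<lambda>w. f (observe n \<alpha> a r w) + f' (observe n \<alpha> a r' (flip_signs D w)))"
  proof (rule integral_mono[OF integrable integrable])
    fix w
    show "indicator ?S w * \<delta> \<le> f (observe n \<alpha> a r w) + f' (observe n \<alpha> a r' (flip_signs D w))"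
      using sep[of "observe n \<alpha> a r w"] nonneg confused[of w]
      by (cases "w \<in> ?S") (auto simp add: indicator_def simp del: mem_Collect_eq)
  qed
  also have "\<dots> = measure_pmf.expectation ?P (\<lambda>w. f (observe n \<alpha> a r w))
      + measure_pmf.expectation (map_pmf (flip_signs D) ?P) (\<lambda>w. f' (observe n \<alpha> a r' w))"
    by (simp add: Bochner_Integration.integral_add[OF integrable integrable])
  finally show ?thesis
    by (simp add: map_flip_signs_coins[OF p])
qed

section \<open>Averaging over a family of hypotheses\<close>

lemma card_filter:
  assumes "finite X"
  shows "card {x \<in> X. P x} = (\<Sum>x\<in>X. of_bool (P x))"
  using assms by (simp add: of_bool_def sum.inter_filter[symmetric])

text \<open>Each \<open>T i\<close> is an involution.  If two members of \<open>\<Theta>\<close> exchanged by \<open>T i\<close> have total loss at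
  least \<open>\<delta>\<close> in coordinate \<open>i\<close>, and each member is matched within \<open>\<Theta>\<close> in at least \<open>h\<close>
  coordinates, then the average over \<open>\<Theta>\<close> of the total loss is at least \<open>h \<delta> / 2\<close>, and some
  member reaches the average.\<close>
lemma averaging_bound:
  fixes g :: "'a \<Rightarrow> 'b \<Rightarrow> real"
  assumes fin: "finite \<Theta>" "\<Theta> \<noteq> {}" "finite I"
    and nonneg: "\<And>A i. A \<in> \<Theta> \<Longrightarrow> i \<in> I \<Longrightarrow> g A i \<ge> 0"
    and inv: "\<And>A i. T i (T i A) = A"
    and pair: "\<And>A i. A \<in> \<Theta> \<Longrightarrow> i \<in> I \<Longrightarrow> T i A \<in> \<Theta> \<Longrightarrow> \<delta> \<le> g A i + g (T i A) i"
    and many: "\<And>A. A \<in> \<Theta> \<Longrightarrow> h \<le> card {i \<in> I. T i A \<in> \<Theta>}"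
    and \<delta>: "\<delta> \<ge> 0"
  shows "\<exists>A\<in>\<Theta>. real h * \<delta> / 2 \<le> (\<Sum>i\<in>I. g A i)"
proof (rule ccontr)
  assume "\<not> ?thesis"
  then have small: "(\<Sum>i\<in>I. g A i) < real h * \<delta> / 2" if "A \<in> \<Theta>" for A
    using that by (auto simp: not_le)
  define U where "U i = {A \<in> \<Theta>. T i A \<in> \<Theta>}" for i
  have U: "finite (U i)" "U i \<subseteq> \<Theta>" for i
    using fin by (auto simp: U_def)
  have half: "card (U i) * \<delta> \<le> 2 * (\<Sum>A\<in>U i. g A i)" if i: "i \<in> I" for i
  proof -
    have "(\<Sum>A\<in>U i. g (T i A) i) = (\<Sum>A\<in>U i. g A i)"
      by (rule sum.reindex_bij_witness[of _ "T i" "T i"]) (auto simp: U_def inv)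
    moreover have "(\<Sum>A\<in>U i. \<delta>) \<le> (\<Sum>A\<in>U i. g A i + g (T i A) i)"
      using pair i by (intro sum_mono) (auto simp: U_def)
    ultimately show ?thesis
      by (simp add: sum.distrib)
  qed
  have count: "(\<Sum>A\<in>\<Theta>. card {i \<in> I. T i A \<in> \<Theta>}) = (\<Sum>i\<in>I. card (U i))"
  proof -
    have "(\<Sum>A\<in>\<Theta>. card {i \<in> I. T i A \<in> \<Theta>}) = (\<Sum>A\<in>\<Theta>. \<Sum>i\<in>I. of_bool (T i A \<in> \<Theta>))"
      using card_filter[OF fin(3)] by simp
    also have "\<dots> = (\<Sum>i\<in>I. \<Sum>A\<in>\<Theta>. of_bool (T i A \<in> \<Theta>))"
      by (rule sum.swap)
    also have "\<dots> = (\<Sum>i\<in>I. card (U i))"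
      using card_filter[OF fin(1)] by (simp add: U_def)
    finally show ?thesis .
  qed
  \<comment> \<open>Double counting of the matched pairs of a hypothesis and a coordinate.\<close>
  have "card \<Theta> * h \<le> (\<Sum>i\<in>I. card (U i))"
    unfolding count[symmetric] using sum_mono[OF many, of \<Theta> "\<lambda>A. A"] by simp
  then have "real (card \<Theta> * h) * \<delta> \<le> real (\<Sum>i\<in>I. card (U i)) * \<delta>"
    using \<delta> by (intro mult_right_mono) (auto simp only: of_nat_le_iff)
  also have "\<dots> = (\<Sum>i\<in>I. card (U i) * \<delta>)"
    by (simp add: sum_distrib_right)
  also have "\<dots> \<le> (\<Sum>i\<in>I. 2 * (\<Sum>A\<in>\<Theta>. g A i))"
  proof (rule sum_mono)
    fix i assume i: "i \<in> I"
    have "(\<Sum>A\<in>U i. g A i) \<le> (\<Sum>A\<in>\<Theta>. g A i)"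
      using fin U nonneg i by (intro sum_mono2) auto
    then show "card (U i) * \<delta> \<le> 2 * (\<Sum>A\<in>\<Theta>. g A i)"
      using half[OF i] by linarith
  qed
  also have "\<dots> = 2 * (\<Sum>A\<in>\<Theta>. \<Sum>i\<in>I. g A i)"
    by (simp add: sum_distrib_left[symmetric] sum.swap[of _ I])
  also have "\<dots> < 2 * (\<Sum>A\<in>\<Theta>. real h * \<delta> / 2)"
    using sum_strict_mono[OF fin(1,2), of "\<lambda>A. \<Sum>i\<in>I. g A i" "\<lambda>_. real h * \<delta> / 2"] small by simp
  finally show False
    by simp
qed

section \<open>Sub-Gaussian row noise\<close>

lemma exp_cosh_bound:
  fixes z :: real
  shows "exp z + exp (- z) - 2 \<le> z\<^sup>2 * exp \<bar>z\<bar>"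
proof -
  have *: "exp z + exp (- z) - 2 \<le> z\<^sup>2 * exp z" if "z \<ge> 0" for z :: real
  proof -
    have "exp z + exp (- z) - 2 = (1 - exp (- z))\<^sup>2 * exp z"
      by (simp add: power2_eq_square algebra_simps flip: exp_add)
    also have "\<dots> \<le> z\<^sup>2 * exp z"
      using that exp_ge_add_one_self[of "- z"] by (intro mult_right_mono power_mono) auto
    finally show ?thesis .
  qed
  show ?thesis
    using *[of z] *[of "- z"] by (cases "z \<ge> 0") (auto simp: add.commute)
qed

text \<open>The coin \<open>a w\<close> with mass \<open>exp (- a\<^sup>2 / 2) / 8\<close> at \<open>\<plusminus>a\<close> has sub-Gaussian moment generating
  function with variance proxy 1, for every \<open>a\<close>.  For \<open>\<bar>y\<bar> > 1\<close> the bound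
  \<open>y a \<le> y\<^sup>2 / 2 + a\<^sup>2 / 2\<close> suffices; for \<open>\<bar>y\<bar> \<le> 1\<close> the mean-zero cancellation is needed to get
  an excess of order \<open>y\<^sup>2\<close>.\<close>
lemma three_point_mgf:
  fixes a y :: real
  defines "w \<equiv> exp (- a\<^sup>2 / 2) / 8"
  shows "w * exp (- (y * a)) + (1 - 2 * w) + w * exp (y * a) \<le> exp (y\<^sup>2 / 2)"
proof (cases "\<bar>y\<bar> \<le> 1")
  case True
  have "\<bar>y * a\<bar> \<le> \<bar>a\<bar>"
    using True by (simp add: abs_mult mult_left_le_one_le)
  then have "(y * a)\<^sup>2 * exp \<bar>y * a\<bar> \<le> (y * a)\<^sup>2 * exp \<bar>a\<bar>"
    by (intro mult_left_mono) auto
  then have "w * (exp (y * a) + exp (- (y * a)) - 2) \<le> w * ((y * a)\<^sup>2 * exp \<bar>a\<bar>)"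
    using exp_cosh_bound[of "y * a"] by (intro mult_left_mono) (auto simp: w_def)
  also have "\<dots> = y\<^sup>2 / 8 * (a\<^sup>2 * exp (\<bar>a\<bar> - a\<^sup>2 / 2))"
    by (simp add: w_def power_mult_distrib exp_diff exp_minus field_simps exp_add[symmetric])
  also have "\<dots> \<le> y\<^sup>2 / 8 * 4"
  proof (rule mult_left_mono)
    \<comment> \<open>The maximum of \<open>a\<^sup>2 exp (a - a\<^sup>2 / 2)\<close> over \<open>a \<ge> 0\<close> is 4, attained at \<open>a = 2\<close>.\<close>
    have "\<bar>a\<bar> \<le> 2 * (1 + (a\<^sup>2 / 4 - \<bar>a\<bar> / 2))"
      using zero_le_power2[of "\<bar>a\<bar> - 2"] by (simp add: power2_eq_square algebra_simps)
    also have "\<dots> \<le> 2 * exp (a\<^sup>2 / 4 - \<bar>a\<bar> / 2)"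
      using exp_ge_add_one_self by (intro mult_left_mono) auto
    finally have "\<bar>a\<bar>\<^sup>2 \<le> (2 * exp (a\<^sup>2 / 4 - \<bar>a\<bar> / 2))\<^sup>2"
      by (intro power_mono) auto
    also have "\<dots> = 4 * exp (a\<^sup>2 / 2 - \<bar>a\<bar>)"
      by (simp add: power_mult_distrib exp_double[symmetric] algebra_simps)
    finally have "a\<^sup>2 * exp (\<bar>a\<bar> - a\<^sup>2 / 2) \<le> 4 * exp (a\<^sup>2 / 2 - \<bar>a\<bar>) * exp (\<bar>a\<bar> - a\<^sup>2 / 2)"
      by (intro mult_right_mono) auto
    then show "a\<^sup>2 * exp (\<bar>a\<bar> - a\<^sup>2 / 2) \<le> 4"
      by (simp add: mult.assoc flip: exp_add)
  qed simp
  finally show ?thesis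
    using exp_ge_add_one_self[of "y\<^sup>2 / 2"] unfolding distrib_left right_diff_distrib by linarith
next
  case False
  have *: "w * exp x \<le> exp (y\<^sup>2 / 2) / 8" if "\<bar>x\<bar> = \<bar>y * a\<bar>" for x
  proof -
    have "x \<le> y\<^sup>2 / 2 + a\<^sup>2 / 2"
      using zero_le_power2[of "\<bar>y\<bar> - \<bar>a\<bar>"] that
      by (simp add: power2_eq_square algebra_simps abs_mult)
    then have "exp (- a\<^sup>2 / 2) * exp x \<le> exp (y\<^sup>2 / 2)"
      by (simp add: mult_exp_exp)
    then show ?thesis
      by (simp add: w_def)
  qed
  have "1 \<le> y\<^sup>2"
    using False abs_square_le_1[of y] by linarith
  then have "3 / 2 \<le> exp (y\<^sup>2 / 2)"
    using exp_ge_add_one_self[of "y\<^sup>2 / 2"] by linarith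
  moreover have "w \<ge> 0"
    by (simp add: w_def)
  ultimately show ?thesis
    using *[of "y * a", OF refl] *[of "- (y * a)", OF abs_minus_cancel] by linarith
qed

lemma measurable_observe: "observe n \<alpha> a r \<in> measurable (measure_pmf P) (array_space n)"
  by (auto simp: observe_def space_PiM)

text \<open>The law of the noise array whose entry \<open>(i, j)\<close> is \<open>a * w i\<close>, the same in all of row \<open>i\<close>.\<close>
definition row_noise :: "nat \<Rightarrow> real \<Rightarrow> real \<Rightarrow> (nat \<times> nat \<Rightarrow> real) measure" where
  "row_noise n a p =
     distr (measure_pmf (coins n p)) (array_space n) (observe n 0 a (\<lambda>_. 0))"

lemma noise_law_row_noise: "noise_law n (row_noise n a p)"
  unfolding noise_law_def row_noise_def
  using measure_pmf.prob_space_distr[OF measurable_observe] by simp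

lemma obs_law_row_noise:
  "obs_law n (\<lambda>k l. \<alpha> * real k) (row_noise n a p) r =
     distr (measure_pmf (coins n p)) (array_space n) (observe n \<alpha> a r)"
proof -
  have shift: "(\<lambda>z. \<lambda>(i, j)\<in>offdiag n. \<alpha> * real (r i) + z (i, j))
      \<in> measurable (array_space n) (array_space n)"
  proof (rule measurable_restrict)
    fix p assume p: "p \<in> offdiag n"
    show "(\<lambda>z. case p of (i, j) \<Rightarrow> \<alpha> * real (r i) + z (i, j)) \<in> borel_measurable (array_space n)"
      by (cases p) (use p in \<open>auto intro: borel_measurable_add measurable_component_singleton\<close>)
  qed
  have "(\<lambda>z. \<lambda>(i, j)\<in>offdiag n. \<alpha> * real (r i) + z (i, j)) \<circ> observe n 0 a (\<lambda>_. 0)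
      = observe n \<alpha> a r"
    by (auto simp: observe_def fun_eq_iff restrict_def)
  then show ?thesis
    unfolding obs_law_def row_noise_def distr_distr[OF shift measurable_observe] by simp
qed

text \<open>A row contains \<open>n - 1\<close> entries, so in a unit direction \<open>v\<close> the row sums \<open>V i\<close> of \<open>v\<close> satisfy
  \<open>\<Sum>\<^sub>i V\<^sub>i\<^sup>2 \<le> n - 1\<close>.  Each coin \<open>a * w i\<close> thus needs the variance proxy
  \<open>\<tau>\<^sup>2 = \<sigma>\<^sup>2 / (n - 1)\<close>, which is what the choice of \<open>p\<close> provides.\<close>
lemma noise_condition_row_noise:
  assumes n: "n \<ge> 2" and \<sigma>: "\<sigma> > 0"
    and p: "p = exp (- a\<^sup>2 * (real n - 1) / (2 * \<sigma>\<^sup>2)) / 8"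
  shows "noise_condition n \<sigma> (row_noise n a p)"
  unfolding noise_condition_def
proof (intro allI impI)
  fix t :: real and v :: "nat \<times> nat \<Rightarrow> real"
  assume t: "t > 0" and v: "(\<Sum>p\<in>offdiag n. (v p)\<^sup>2) = 1"
  let ?P = "coins n p"
  define V where "V i = (\<Sum>j\<in>{1..n} - {i}. v (i, j))" for i
  define S where "S w = (\<Sum>i=1..n. V i * (a * of_int (w i)))" for w :: "nat \<Rightarrow> int"
  define \<tau> where "\<tau> = \<sigma> / sqrt (real n - 1)"
  \<comment> \<open>The optimal exponent in Chernoff's bound.\<close>
  define u where "u = t / \<sigma>\<^sup>2"
  have \<tau>: "\<tau> > 0" "\<tau>\<^sup>2 = \<sigma>\<^sup>2 / (real n - 1)"
    using n \<sigma> by (auto simp: \<tau>_def power_divide)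
  have p01: "0 \<le> p" "p \<le> 1 / 2"
  proof -
    have "exp (- a\<^sup>2 * (real n - 1) / (2 * \<sigma>\<^sup>2)) \<le> 1"
      using n by (simp add: divide_nonpos_nonneg mult_nonpos_nonneg)
    then show "p \<le> 1 / 2"
      unfolding p by linarith
  qed (simp add: p)
  have p': "p = exp (- (a / \<tau>)\<^sup>2 / 2) / 8"
    using \<tau> n \<sigma> by (simp add: p power_divide)
  have V: "(\<Sum>i=1..n. (V i)\<^sup>2) \<le> real n - 1"
  proof -
    have "(\<Sum>i=1..n. (V i)\<^sup>2) \<le> (\<Sum>i=1..n. \<Sum>j\<in>{1..n} - {i}. (real n - 1) * (v (i, j))\<^sup>2)"
    proof (rule sum_mono)
      fix i assume i: "i \<in> {1..n}"
      have "(V i)\<^sup>2 \<le> (\<Sum>j\<in>{1..n} - {i}. 1\<^sup>2) * (\<Sum>j\<in>{1..n} - {i}. (v (i, j))\<^sup>2)"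
        unfolding V_def
        using Cauchy_Schwarz_ineq_sum[of "\<lambda>_. 1" "\<lambda>j. v (i, j)" "{1..n} - {i}"] by simp
      also have "\<dots> = (\<Sum>j\<in>{1..n} - {i}. (real n - 1) * (v (i, j))\<^sup>2)"
        using i n by (simp add: sum_distrib_left of_nat_diff)
      finally show "(V i)\<^sup>2 \<le> (\<Sum>j\<in>{1..n} - {i}. (real n - 1) * (v (i, j))\<^sup>2)" .
    qed
    also have "\<dots> = real n - 1"
      using v by (simp add: sum_offdiag sum_distrib_left[symmetric])
    finally show ?thesis .
  qed
  have integrable: "integrable (measure_pmf ?P) g" for g :: "_ \<Rightarrow> real"
    by (rule integrable_measure_pmf_finite[OF finite_set_coins[OF p01]])
  have meas: "{z \<in> space (array_space n). t < (\<Sum>p\<in>offdiag n. v p * z p)} \<in> sets (array_space n)"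
    by measurable
  have S: "(\<Sum>p\<in>offdiag n. v p * observe n 0 a (\<lambda>_. 0) w p) = S w" for w
  proof -
    have "(\<Sum>p\<in>offdiag n. v p * observe n 0 a (\<lambda>_. 0) w p)
        = (\<Sum>p\<in>offdiag n. v p * (a * of_int (w (fst p))))"
      by (intro sum.cong) (auto simp: observe_def)
    also have "\<dots> = S w"
      by (simp add: sum_offdiag S_def V_def sum_distrib_right)
    finally show ?thesis .
  qed
  have "measure (row_noise n a p) {z \<in> space (row_noise n a p). (\<Sum>p\<in>offdiag n. v p * z p) > t}
      = measure_pmf.prob ?P {w. S w > t}"
    unfolding row_noise_def space_distr
    unfolding measure_distr[OF measurable_observe meas]
    using measurable_space[OF measurable_observe]
    by (intro arg_cong[where f = "measure_pmf.prob ?P"]) (auto simp: S)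
  also have "\<dots> = measure_pmf.expectation ?P (indicator {w. S w > t})"
    by simp
  also have "\<dots> \<le> measure_pmf.expectation ?P (\<lambda>w. exp (- u * t) * exp (u * S w))"
  proof (rule integral_mono[OF integrable integrable])
    fix w
    have "t < S w \<Longrightarrow> u * t \<le> u * S w"
      using t \<sigma> by (intro mult_left_mono) (auto simp: u_def)
    then show "indicator {w. S w > t} w \<le> exp (- u * t) * exp (u * S w)"
      by (auto simp: indicator_def mult_exp_exp)
  qed
  also have "\<dots> = exp (- u * t) *
      measure_pmf.expectation ?P (\<lambda>w. \<Prod>i=1..n. exp (u * V i * a * of_int (w i)))"
    by (simp add: S_def exp_sum[symmetric] sum_distrib_left mult_ac)
  also have "measure_pmf.expectation ?P (\<lambda>w. \<Prod>i=1..n. exp (u * V i * a * of_int (w i)))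
      = (\<Prod>i=1..n. measure_pmf.expectation (three_point_pmf p) (\<lambda>x. exp (u * V i * a * of_int x)))"
    unfolding coins_def
  proof (rule expectation_prod_Pi_pmf)
    have "finite (set_pmf (three_point_pmf p))"
      using set_three_point[OF p01] by (rule finite_subset) simp
    then show "integrable (measure_pmf (three_point_pmf p)) (\<lambda>x. exp (u * V i * a * of_int x))" for i
      by (rule integrable_measure_pmf_finite)
  qed auto
  also have "\<dots> \<le> (\<Prod>i=1..n. exp ((u * V i * \<tau>)\<^sup>2 / 2))"
  proof (intro prod_mono conjI)
    fix i
    have eq: "(u * V i * \<tau>) * (a / \<tau>) = u * V i * a"
      using \<tau> by simp
    then show "measure_pmf.expectation (three_point_pmf p) (\<lambda>x. exp (u * V i * a * of_int x))
        \<le> exp ((u * V i * \<tau>)\<^sup>2 / 2)"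
      using three_point_mgf[of "a / \<tau>" "u * V i * \<tau>"]
      unfolding p'[symmetric] eq expectation_three_point[OF p01] by simp
  qed (simp add: Bochner_Integration.integral_nonneg)
  also have "\<dots> = exp ((u * \<tau>)\<^sup>2 / 2 * (\<Sum>i=1..n. (V i)\<^sup>2))"
    by (simp add: exp_sum[symmetric] sum_distrib_left power_mult_distrib mult_ac)
  also have "\<dots> \<le> exp ((u * \<tau>)\<^sup>2 / 2 * (real n - 1))"
    using V by (simp add: mult_left_mono)
  also have "exp (- u * t) * exp ((u * \<tau>)\<^sup>2 / 2 * (real n - 1)) = exp (- t\<^sup>2 / (2 * \<sigma>\<^sup>2))"
  proof -
    have "(u * \<tau>)\<^sup>2 / 2 * (real n - 1) = u\<^sup>2 * (\<tau>\<^sup>2 * (real n - 1)) / 2"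
      by (simp add: power_mult_distrib)
    also have "\<tau>\<^sup>2 * (real n - 1) = \<sigma>\<^sup>2"
      using \<tau> n by simp
    also have "u\<^sup>2 * \<sigma>\<^sup>2 / 2 = t\<^sup>2 / (2 * \<sigma>\<^sup>2)"
      using \<sigma> by (simp add: u_def power2_eq_square)
    finally have "(u * \<tau>)\<^sup>2 / 2 * (real n - 1) = t\<^sup>2 / (2 * \<sigma>\<^sup>2)" .
    moreover have "u * t = t\<^sup>2 / \<sigma>\<^sup>2"
      by (simp add: u_def power2_eq_square)
    ultimately show ?thesis
      by (simp add: mult_exp_exp)
  qed
  finally show "measure (row_noise n a p) {z \<in> space (row_noise n a p). (\<Sum>p\<in>offdiag n. v p * z p) > t}
      \<le> exp (- t\<^sup>2 / (2 * \<sigma>\<^sup>2))"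
    by simp
qed

section \<open>Perturbed rankings\<close>

text \<open>The ranking that raises the ranks in \<open>A\<close> by \<open>k\<close> above a base ranking, where the base
  ranking is the identity lowered by \<open>k\<close> on \<open>{h+1..2*h}\<close>.  For \<open>A = {h+1..2*h}\<close> it is the
  identity; in general its sum deviates from that of the identity by \<open>k (card A - h)\<close>.  For
  \<open>k \<le> h\<close> the subtraction on natural numbers never truncates, and for \<open>2 * h \<le> n\<close> and
  \<open>A \<subseteq> {1..2*h}\<close> all ranks stay in \<open>{1..n}\<close>.\<close>
definition shifted_ranking :: "nat \<Rightarrow> nat \<Rightarrow> nat \<Rightarrow> nat set \<Rightarrow> nat \<Rightarrow> nat" where
  "shifted_ranking n h k A =
     (\<lambda>i\<in>{1..n}. (i + (if i \<in> A then k else 0)) - (if i \<in> {h+1..2*h} then k else 0))"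

lemma shifted_ranking_of_nat:
  assumes "i \<in> {1..n}" "k \<le> h"
  shows "real (shifted_ranking n h k A i) =
    real i + (if i \<in> A then real k else 0) - (if i \<in> {h+1..2*h} then real k else 0)"
  using assms by (auto simp: shifted_ranking_def of_nat_diff)

lemma shifted_ranking_in_rank_space:
  assumes h: "2 * h \<le> n" "k \<le> h" and A: "A \<subseteq> {1..2*h}"
    and b: "\<bar>real k * (real (card A) - real h)\<bar> \<le> b"
  shows "shifted_ranking n h k A \<in> rank_space n b"
proof -
  have "shifted_ranking n h k A \<in> grid n"
  proof (rule PiE_I)
    fix i assume i: "i \<in> {1..n}"
    show "shifted_ranking n h k A i \<in> {1..n}"
      using i h A by (cases "i \<in> {h+1..2*h}") (auto simp: shifted_ranking_def)
  qed (auto simp: shifted_ranking_def)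
  moreover have "(\<Sum>i=1..n. real (shifted_ranking n h k A i)) - (\<Sum>i=1..n. real i)
      = real k * (real (card A) - real h)"
  proof -
    have count: "(\<Sum>i=1..n. if i \<in> B then real k else 0) = real k * card ({1..n} \<inter> B)" for B
      by (simp add: sum.inter_restrict[symmetric])
    have "(\<Sum>i=1..n. real (shifted_ranking n h k A i)) = (\<Sum>i=1..n.
        real i + (if i \<in> A then real k else 0) - (if i \<in> {h+1..2*h} then real k else 0))"
      using h by (intro sum.cong shifted_ranking_of_nat) auto
    also have "\<dots> = (\<Sum>i=1..n. real i) + real k * card ({1..n} \<inter> A)
        - real k * card ({1..n} \<inter> {h+1..2*h})"
      unfolding sum_subtractf sum.distrib count by simp
    also have "{1..n} \<inter> A = A"
      using A h by auto
    also have "{1..n} \<inter> {h+1..2*h} = {h+1..2*h}"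
      using h by auto
    finally show ?thesis
      by (simp add: algebra_simps)
  qed
  ultimately show ?thesis
    using b by (simp add: rank_space_def)
qed

section \<open>From hypotheses to the minimax risk\<close>

text \<open>The contribution of one coordinate to \<open>n\<close> times the loss.\<close>
definition coord_loss :: "real \<Rightarrow> nat \<Rightarrow> nat \<Rightarrow> real" where
  "coord_loss q x y = (if q = 0 then of_bool (x \<noteq> y) else \<bar>real x - real y\<bar> powr q)"

lemma coord_loss_nonneg: "coord_loss q x y \<ge> 0"
  by (simp add: coord_loss_def)

lemma loss_eq_sum_coord_loss: "loss n q r' r = (\<Sum>i=1..n. coord_loss q (r' i) (r i)) / real n"
  by (simp add: loss_def coord_loss_def)

lemma coord_loss_separation:
  assumes "q \<ge> 0" "\<delta> > 0" "\<bar>real y - real z\<bar> = \<delta>"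
  shows "coord_loss q x y + coord_loss q x z \<ge> (\<delta> / 2) powr q"
proof (cases "q = 0")
  case True
  have "y \<noteq> z"
    using assms by auto
  then show ?thesis
    using True assms by (auto simp: coord_loss_def)
next
  case False
  have "\<delta> / 2 \<le> \<bar>real x - real y\<bar> \<or> \<delta> / 2 \<le> \<bar>real x - real z\<bar>"
    using assms by linarith
  then have "(\<delta> / 2) powr q \<le> \<bar>real x - real y\<bar> powr q \<or> (\<delta> / 2) powr q \<le> \<bar>real x - real z\<bar> powr q"
    using assms by (auto intro: powr_mono2)
  moreover have "\<bar>real x - real y\<bar> powr q \<ge> 0" "\<bar>real x - real z\<bar> powr q \<ge> 0"
    by simp_all
  ultimately show ?thesis
    unfolding coord_loss_def if_not_P[OF False] by linarith
qed

text \<open>A family \<open>\<Theta>\<close> of subsets of \<open>{1..2*h}\<close> parametrises the hypotheses.  The set \<open>D i\<close> lists the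
  ranks that have to change together with the rank of \<open>i\<close> in order to stay in the family; the
  exponent \<open>d\<close> is the number of coins that must take a prescribed value for the confusion.\<close>
lemma minimax_risk_lower_bound:
  fixes \<Theta> :: "nat set set" and D :: "nat \<Rightarrow> nat set"
  assumes q: "q \<ge> 0" and p: "0 \<le> p" "p \<le> 1 / 2"
    and h: "2 * h \<le> n" "1 \<le> k" "k \<le> h"
    and \<Theta>: "\<Theta> \<noteq> {}" "\<And>A. A \<in> \<Theta> \<Longrightarrow> A \<subseteq> {1..2*h}"
    and rank: "\<And>A. A \<in> \<Theta> \<Longrightarrow> shifted_ranking n h k A \<in> rank_space n b"
    and I: "I \<subseteq> {1..n}"
    and D: "\<And>i. i \<in> I \<Longrightarrow> i \<in> D i" "\<And>i. i \<in> I \<Longrightarrow> D i \<subseteq> {1..n}" "\<And>i. i \<in> I \<Longrightarrow> card (D i) = d"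
    and many: "\<And>A. A \<in> \<Theta> \<Longrightarrow> h \<le> card {i \<in> I. sym_diff A (D i) \<in> \<Theta>}"
  shows "real h * (p ^ d * (real k / 2) powr q) / (2 * real n)
      \<le> minimax_risk n b q (\<lambda>k l. \<alpha> * real k) (row_noise n (\<alpha> * real k / 2) p)"
  unfolding minimax_risk_def
proof (rule cINF_greatest)
  have "(\<lambda>_. \<lambda>i\<in>{1..n}. i) \<in> estimators n"
    by (intro measurable_const) (auto simp: space_count_space)
  then show "estimators n \<noteq> {}"
    by blast
next
  fix est assume est: "est \<in> estimators n"
  let ?a = "\<alpha> * real k / 2" and ?P = "coins n p"
  let ?R = "\<lambda>r. integral\<^sup>L (obs_law n (\<lambda>k l. \<alpha> * real k) (row_noise n ?a p) r)
                  (\<lambda>x. loss n q (est x) r)"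
  define rk where "rk = shifted_ranking n h k"
  define \<delta> where "\<delta> = p ^ d * (real k / 2) powr q"
  define g where "g A i = measure_pmf.expectation ?P
      (\<lambda>w. coord_loss q (est (observe n \<alpha> ?a (rk A) w) i) (rk A i))" for A i
  have integrable: "integrable (measure_pmf ?P) f" for f :: "_ \<Rightarrow> real"
    by (rule integrable_measure_pmf_finite[OF finite_set_coins[OF p]])
  have risk: "?R (rk A) = (\<Sum>i=1..n. g A i) / real n" for A
  proof -
    have "(\<lambda>x. loss n q (est x) (rk A)) \<in> borel_measurable (array_space n)"
      by (rule measurable_compose[OF est]) simp
    then have "?R (rk A)
        = measure_pmf.expectation ?P (\<lambda>w. loss n q (est (observe n \<alpha> ?a (rk A) w)) (rk A))"
      unfolding obs_law_row_noise by (rule integral_distr[OF measurable_observe])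
    then show ?thesis
      by (simp add: loss_eq_sum_coord_loss g_def integrable)
  qed
  have pair: "\<delta> \<le> g A i + g (sym_diff A (D i)) i"
    if A: "A \<in> \<Theta>" "sym_diff A (D i) \<in> \<Theta>" and i: "i \<in> I" for A i
  proof -
    define s :: "nat \<Rightarrow> int" where "s j = (if j \<in> A then -1 else 1)" for j
    have diff: "real (rk (sym_diff A (D i)) j) - real (rk A j)
        = (if j \<in> D i then real k * of_int (s j) else 0)" if "j \<in> {1..n}" for j
      unfolding rk_def shifted_ranking_of_nat[OF that h(3)] by (auto simp: s_def)
    have "\<bar>real (rk A i) - real (rk (sym_diff A (D i)) i)\<bar> = real k"
      using diff[of i] D(1)[OF i] I i by (auto simp: s_def split: if_splits)
    then have "p ^ card (D i) * (real k / 2) powr q \<le> g A i + g (sym_diff A (D i)) i"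
      unfolding g_def using h
      by (intro two_point_bound[OF p D(2)[OF i] _ diff,
            where f = "\<lambda>x. coord_loss q (est x i) (rk A i)"
              and f' = "\<lambda>x. coord_loss q (est x i) (rk (sym_diff A (D i)) i)"]
          coord_loss_separation[OF q]) (auto simp: s_def coord_loss_nonneg)
    then show ?thesis
      by (simp add: \<delta>_def D(3)[OF i])
  qed
  have g: "g A i \<ge> 0" for A i
    by (simp add: g_def coord_loss_nonneg)
  have "\<exists>A\<in>\<Theta>. real h * \<delta> / 2 \<le> (\<Sum>i\<in>I. g A i)"
  proof (rule averaging_bound[where T = "\<lambda>i A. sym_diff A (D i)"])
    show "finite \<Theta>"
      by (rule finite_subset[of _ "Pow {1..2*h}"]) (use \<Theta>(2) in auto)
    show "finite I"
      using I by (rule finite_subset) simp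
  qed (use \<Theta> g pair many p in \<open>auto simp: \<delta>_def\<close>)
  then obtain A where A: "A \<in> \<Theta>" "real h * \<delta> / 2 \<le> (\<Sum>i\<in>I. g A i)"
    by blast
  have "(\<Sum>i\<in>I. g A i) \<le> (\<Sum>i=1..n. g A i)"
    using I g by (intro sum_mono2) auto
  then have "real h * \<delta> / 2 / real n \<le> (\<Sum>i=1..n. g A i) / real n"
    using A(2) by (intro divide_right_mono) auto
  also have "\<dots> = ?R (rk A)"
    by (simp only: risk)
  also have "\<dots> \<le> (SUP r\<in>rank_space n b. ?R r)"
    using rank[OF A(1)] by (intro cSUP_upper bdd_above_finite) (auto simp: rk_def finite_rank_space)
  finally show "real h * (p ^ d * (real k / 2) powr q) / (2 * real n) \<le> (SUP r\<in>rank_space n b. ?R r)"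
    by (simp add: \<delta>_def)
qed

section \<open>The two families of hypotheses\<close>

text \<open>The family consists of the two middle levels of the cube on \<open>{1..2*h}\<close>.  A set with \<open>h\<close> elements
  stays in the family when any of the \<open>h\<close> missing elements is added, and one with \<open>h + 1\<close>
  elements when any of its elements is removed.\<close>
lemma minimax_risk_toggle:
  assumes q: "q \<ge> 0" and p: "0 \<le> p" "p \<le> 1 / 2"
    and h: "2 * h \<le> n" "1 \<le> h" and b: "b \<ge> 1"
  shows "real h * (p * (1 / 2) powr q) / (2 * real n)
      \<le> minimax_risk n b q (\<lambda>k l. \<alpha> * real k) (row_noise n (\<alpha> / 2) p)"
proof -
  let ?I = "{1..2*h}"
  define \<Theta> where "\<Theta> = {A. A \<subseteq> ?I \<and> (card A = h \<or> card A = h + 1)}"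
  have "real h * (p ^ 1 * (real 1 / 2) powr q) / (2 * real n)
      \<le> minimax_risk n b q (\<lambda>k l. \<alpha> * real k) (row_noise n (\<alpha> * real 1 / 2) p)"
  proof (rule minimax_risk_lower_bound[where \<Theta> = \<Theta> and D = "\<lambda>i. {i}" and I = ?I])
    have "{1..h} \<in> \<Theta>"
      by (auto simp: \<Theta>_def)
    then show "\<Theta> \<noteq> {}"
      by blast
    fix A assume A: "A \<in> \<Theta>"
    then have sub: "A \<subseteq> ?I" and fin: "finite A" and card: "card A = h \<or> card A = h + 1"
      by (auto simp: \<Theta>_def intro: finite_subset)
    show "A \<subseteq> ?I"
      by (fact sub)
    show "shifted_ranking n h 1 A \<in> rank_space n b"
      using h b sub card by (intro shifted_ranking_in_rank_space) auto
    define B where "B = (if card A = h then ?I - A else A)"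
    have "h \<le> card B"
      using card sub fin by (auto simp: B_def card_Diff_subset)
    also have "card B \<le> card {i \<in> ?I. sym_diff A {i} \<in> \<Theta>}"
    proof (rule card_mono)
      show "B \<subseteq> {i \<in> ?I. sym_diff A {i} \<in> \<Theta>}"
      proof
        fix i assume i: "i \<in> B"
        then have "i \<in> ?I"
          using sub by (auto simp: B_def split: if_splits)
        moreover have "card (sym_diff A {i}) = (if card A = h then h + 1 else h)"
        proof (cases "card A = h")
          case True
          then have "sym_diff A {i} = insert i A" "i \<notin> A"
            using i by (auto simp: B_def)
          then show ?thesis
            using True fin by simp
        next
          case False
          then have "sym_diff A {i} = A - {i}" "i \<in> A"
            using i by (auto simp: B_def)
          then show ?thesis
            using False card fin by simp
        qed
        ultimately show "i \<in> {i \<in> ?I. sym_diff A {i} \<in> \<Theta>}"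
          using sub by (auto simp: \<Theta>_def)
      qed
    qed simp
    finally show "h \<le> card {i \<in> ?I. sym_diff A {i} \<in> \<Theta>}" .
  qed (use q p h in auto)
  then show ?thesis
    by simp
qed

text \<open>The family consists of the sets that contain exactly one element of each pair \<open>{j, j + h}\<close>, with
  \<open>1 \<le> j \<le> h\<close>.  Exchanging the two elements of a pair preserves the family.\<close>
lemma minimax_risk_swap:
  assumes q: "q \<ge> 0" and p: "0 \<le> p" "p \<le> 1 / 2"
    and h: "2 * h \<le> n" "1 \<le> k" "k \<le> h" and b: "b \<ge> 0"
  shows "real h * (p\<^sup>2 * (real k / 2) powr q) / (2 * real n)
      \<le> minimax_risk n b q (\<lambda>k l. \<alpha> * real k) (row_noise n (\<alpha> * real k / 2) p)"
proof -
  define \<Theta> where "\<Theta> = {A. A \<subseteq> {1..2*h} \<and> (\<forall>j\<in>{1..h}. j \<in> A \<longleftrightarrow> j + h \<notin> A)}"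
  show ?thesis
  proof (rule minimax_risk_lower_bound[where \<Theta> = \<Theta> and D = "\<lambda>i. {i, i + h}" and I = "{1..h}"])
    have "{1..h} \<in> \<Theta>"
      by (auto simp: \<Theta>_def)
    then show "\<Theta> \<noteq> {}"
      by blast
    fix A assume A: "A \<in> \<Theta>"
    then have sub: "A \<subseteq> {1..2*h}" and pairs: "\<And>j. j \<in> {1..h} \<Longrightarrow> j \<in> A \<longleftrightarrow> j + h \<notin> A"
      by (auto simp: \<Theta>_def)
    show "A \<subseteq> {1..2*h}"
      by (fact sub)
    have "A = ({1..h} \<inter> A) \<union> (\<lambda>j. j + h) ` ({1..h} - A)" (is "_ = ?B \<union> ?C")
    proof (intro set_eqI iffI)
      fix i assume i: "i \<in> A"
      show "i \<in> ?B \<union> ?C"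
      proof (cases "i \<le> h")
        case True
        then show ?thesis
          using i sub by auto
      next
        case False
        then have "i = (i - h) + h" "i - h \<in> {1..h}"
          using i sub by auto
        then show ?thesis
          using pairs[of "i - h"] i by (metis DiffI UnI2 image_eqI)
      qed
    next
      fix i assume "i \<in> ?B \<union> ?C"
      then show "i \<in> A"
        using pairs by auto
    qed
    then have "card A = card (?B \<union> ?C)"
      by simp
    also have "\<dots> = card ?B + card ?C"
      by (rule card_Un_disjoint) auto
    also have "card ?C = card ({1..h} - A)"
      by (rule card_image) (simp add: inj_on_def)
    also have "card ?B + card ({1..h} - A) = card {1..h}"
      by (rule card_Int_Diff[symmetric]) simp
    finally have "card A = h"
      by simp
    then show "shifted_ranking n h k A \<in> rank_space n b"
      using h b sub by (intro shifted_ranking_in_rank_space) auto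
    have "sym_diff A {i, i + h} \<in> \<Theta>" if i: "i \<in> {1..h}" for i
    proof -
      have "sym_diff A {i, i + h} \<subseteq> {1..2*h}"
        using sub i by auto
      moreover have "j \<in> sym_diff A {i, i + h} \<longleftrightarrow> j + h \<notin> sym_diff A {i, i + h}"
        if j: "j \<in> {1..h}" for j
      proof -
        have "j \<noteq> i + h" "j + h \<noteq> i"
          using i j by auto
        then show ?thesis
          using pairs[OF j] by (cases "j = i") auto
      qed
      ultimately show ?thesis
        unfolding \<Theta>_def by blast
    qed
    then have "{i \<in> {1..h}. sym_diff A {i, i + h} \<in> \<Theta>} = {1..h}"
      by blast
    then show "h \<le> card {i \<in> {1..h}. sym_diff A {i, i + h} \<in> \<Theta>}"
      by simp
  qed (use q p h in auto)
qed

section \<open>Choice of the parameters\<close>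

lemma model_conditions:
  fixes \<beta> \<sigma> :: real and k :: nat
  assumes n: "n \<ge> 2" and M: "M \<ge> 1" and \<sigma>: "\<sigma> > 0"
  defines "\<alpha> \<equiv> sqrt (2 * real n / (real n - 1)) * \<beta>"
    and "p \<equiv> exp (- (real k)\<^sup>2 * snr n \<beta> \<sigma>) / 8"
  shows "noise_condition n \<sigma> (row_noise n (\<alpha> * real k / 2) p)"
    and "signal_condition n b \<beta> (\<lambda>k l. \<alpha> * real k)"
    and "upper_signal_condition n b M \<beta> (\<lambda>k l. \<alpha> * real k)"
proof -
  have \<alpha>: "\<alpha>\<^sup>2 * (real n - 1) = 2 * real n * \<beta>\<^sup>2"
    using n by (simp add: \<alpha>_def power_mult_distrib)
  have "(\<alpha> * real k / 2)\<^sup>2 * (real n - 1) / (2 * \<sigma>\<^sup>2)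
      = (real k)\<^sup>2 * (\<alpha>\<^sup>2 * (real n - 1)) / (8 * \<sigma>\<^sup>2)"
    by (simp add: power_mult_distrib power_divide)
  also have "\<dots> = (real k)\<^sup>2 * snr n \<beta> \<sigma>"
    unfolding \<alpha> by (simp add: snr_def)
  finally have "p = exp (- (\<alpha> * real k / 2)\<^sup>2 * (real n - 1) / (2 * \<sigma>\<^sup>2)) / 8"
    by (simp add: p_def)
  then show "noise_condition n \<sigma> (row_noise n (\<alpha> * real k / 2) p)"
    by (rule noise_condition_row_noise[OF n \<sigma>])
  have "signal_diff n (\<lambda>k l. \<alpha> * real k) r' r = 2 * real n * \<beta>\<^sup>2 * (rank_dist n r' r)\<^sup>2" for r r'
    using n by (simp add: signal_diff_row \<alpha>)
  moreover have "2 * real n * \<beta>\<^sup>2 * x\<^sup>2 \<le> 2 * M * real n * \<beta>\<^sup>2 * x\<^sup>2" for x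
    using M by (intro mult_right_mono) auto
  ultimately show "signal_condition n b \<beta> (\<lambda>k l. \<alpha> * real k)"
    "upper_signal_condition n b M \<beta> (\<lambda>k l. \<alpha> * real k)"
    by (simp_all add: signal_condition_def upper_signal_condition_def)
qed

text \<open>The step \<open>k\<close> is the integer part of \<open>1 / sqrt s\<close>, capped at \<open>h\<close>.  The constant 36 is \<open>6\<^sup>2\<close>: since
  \<open>k\<close> is at least a third of \<open>min (1 / sqrt s) n\<close>, the base \<open>k / 2\<close> is at least a sixth of it,
  and \<open>q \<le> 2\<close>.\<close>
lemma confusion_scale:
  assumes h: "h \<ge> 1" "real n \<le> 3 * real h" and s: "0 \<le> s" "s \<le> 1" and q: "0 \<le> q" "q \<le> 2"
  obtains k where "1 \<le> k" "k \<le> h" "(real k)\<^sup>2 * s \<le> 1"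
    "rate n q 0 s / 36 \<le> (real k / 2) powr q"
proof -
  have const: "x / 36 \<le> (1 / 6) powr q * x" if "x \<ge> 0" for x :: real
  proof -
    have "(1 / 6 :: real) powr 2 \<le> (1 / 6) powr q"
      using q by (intro powr_mono') auto
    from mult_right_mono[OF this that] show ?thesis
      by (simp add: power2_eq_square)
  qed
  show thesis
  proof (cases "s = 0")
    case True
    have "rate n q 0 s / 36 \<le> (1 / 6) powr q * real n powr q"
      using const[of "real n powr q"] True by (simp add: rate_def)
    also have "\<dots> = (real n / 6) powr q"
      by (simp add: powr_mult[symmetric])
    also have "\<dots> \<le> (real h / 2) powr q"
      using h q by (intro powr_mono2) auto
    finally show thesis
      using that[of h] h True by simp
  next
    case False
    with s have s_pos: "s > 0" by simp
    define x where "x = 1 / sqrt s"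
    have x: "x \<ge> 1" "x\<^sup>2 * s = 1"
      using s_pos s by (auto simp: x_def power_divide)
    define k where "k = min h (nat \<lfloor>x\<rfloor>)"
    have k1: "1 \<le> k" "k \<le> h"
      using h x by (auto simp: k_def le_nat_floor)
    have "real (nat \<lfloor>x\<rfloor>) \<le> x"
      using x by (intro of_nat_floor) auto
    then have "real k \<le> x"
      by (auto simp: k_def)
    then have "(real k)\<^sup>2 * s \<le> x\<^sup>2 * s"
      using s by (intro mult_right_mono power_mono) auto
    then have k2: "(real k)\<^sup>2 * s \<le> 1"
      using x by simp
    have "1 \<le> \<lfloor>x\<rfloor>"
      using x by simp
    then have "x / 3 \<le> real (nat \<lfloor>x\<rfloor>)"
      by linarith
    then have lower: "min x (real n) / 6 \<le> real k / 2"
      using h by (auto simp: k_def min_def)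
    have "x powr q = s powr (- q / 2)"
      using s_pos by (simp add: x_def powr_half_sqrt[symmetric] powr_divide powr_powr powr_minus_divide)
    then have "rate n q 0 s = min (x powr q) (real n powr q)"
      using False s by (simp add: rate_def)
    also have "\<dots> \<le> min x (real n) powr q"
      by (simp add: min_def)
    finally have "rate n q 0 s / 36 \<le> min x (real n) powr q / 36"
      by simp
    also have "\<dots> \<le> (1 / 6) powr q * min x (real n) powr q"
      by (rule const) simp
    also have "\<dots> = (min x (real n) / 6) powr q"
      using x by (simp add: powr_mult[symmetric])
    also have "\<dots> \<le> (real k / 2) powr q"
      using lower x q by (intro powr_mono2) auto
    finally show thesis
      using that k1 k2 by blast
  qed
qed

text \<open>In both regimes \<open>h / (2 n) \<ge> 1 / 6\<close>.  For \<open>s \<le> 1\<close> the remaining factors are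
  \<open>p\<^sup>2 \<ge> exp (- 2) / 64\<close> and the \<open>1 / 36\<close> from the choice of \<open>k\<close>, and \<open>6 * 64 * 36 = 13824\<close>; for
  \<open>s > 1\<close> the constant \<open>1 / (6 * 8 * 4)\<close> is larger.\<close>
lemma minimax_lower_bound:
  fixes \<beta> \<sigma> b q M :: real
  assumes n: "n \<ge> 2" and M: "M \<ge> 1" and \<sigma>: "\<sigma> > 0" and b: "b \<ge> 1" and q: "0 \<le> q" "q \<le> 2"
  shows "\<exists>\<mu> N. noise_law n N \<and> noise_condition n \<sigma> N \<and> signal_condition n b \<beta> \<mu> \<and>
    upper_signal_condition n b M \<beta> \<mu> \<and>
    exp (- 2) / 13824 * rate n q 0 (snr n \<beta> \<sigma>) \<le> minimax_risk n b q \<mu> N"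
proof -
  define s where "s = snr n \<beta> \<sigma>"
  define h where "h = n div 2"
  define \<alpha> where "\<alpha> = sqrt (2 * real n / (real n - 1)) * \<beta>"
  define p where "p k = exp (- (real k)\<^sup>2 * s) / 8" for k :: nat
  have s: "s \<ge> 0"
    by (simp add: s_def snr_def)
  have p: "0 \<le> p k" "p k \<le> 1 / 2" for k
  proof -
    have "exp (- (real k)\<^sup>2 * s) \<le> 1"
      using s by simp
    then show "p k \<le> 1 / 2"
      unfolding p_def by linarith
  qed (simp add: p_def)
  have h: "2 * h \<le> n" "h \<ge> 1" "n \<le> 3 * h"
    using n by (auto simp: h_def)
  then have h3: "real n \<le> 3 * real h"
    by linarith
  have "\<exists>k. exp (- 2) / 13824 * rate n q 0 s
      \<le> minimax_risk n b q (\<lambda>k l. \<alpha> * real k) (row_noise n (\<alpha> * real k / 2) (p k))"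
  proof (cases "s > 1")
    case True
    have "exp (- 2 :: real) \<le> 1"
      by simp
    then have "exp (- 2) / 13824 \<le> (1 / 192 :: real)"
      by linarith
    from mult_right_mono[OF this, of "exp (- s)"]
    have "exp (- 2) / 13824 * rate n q 0 s \<le> 1 / 6 * (exp (- s) / 8 * (1 / 4))"
      using True by (simp add: rate_def)
    also have "\<dots> \<le> real h / (2 * real n) * (p 1 * (1 / 2) powr q)"
    proof (intro mult_mono)
      show "1 / 6 \<le> real h / (2 * real n)"
        using h3 n by (simp add: field_simps)
      have "(1 / 2 :: real) powr 2 \<le> (1 / 2) powr q"
        using q by (intro powr_mono') auto
      then show "1 / 4 \<le> (1 / 2 :: real) powr q"
        by (simp add: power2_eq_square)
    qed (auto simp: p_def)
    also have "\<dots> \<le> minimax_risk n b q (\<lambda>k l. \<alpha> * real k) (row_noise n (\<alpha> / 2) (p 1))"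
      using minimax_risk_toggle[OF q(1) p h(1,2) b, of 1 \<alpha>] by simp
    finally show ?thesis
      by (intro exI[of _ 1]) simp
  next
    case False
    then have "s \<le> 1"
      by simp
    from confusion_scale[OF h(2) h3 s this q]
    obtain k where k: "1 \<le> k" "k \<le> h" "(real k)\<^sup>2 * s \<le> 1"
      and rate: "rate n q 0 s / 36 \<le> (real k / 2) powr q"
      by blast
    have "exp (- 2) / 13824 * rate n q 0 s = 1 / 6 * (exp (- 2) / 64 * (rate n q 0 s / 36))"
      by simp
    also have "\<dots> \<le> real h / (2 * real n) * ((p k)\<^sup>2 * (real k / 2) powr q)"
    proof (intro mult_mono rate)
      show "1 / 6 \<le> real h / (2 * real n)"
        using h3 n by (simp add: field_simps)
      have "(p k)\<^sup>2 = exp (- 2 * ((real k)\<^sup>2 * s)) / 64"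
        by (simp add: p_def power_divide exp_double[symmetric])
      then show "exp (- 2) / 64 \<le> (p k)\<^sup>2"
        using k by simp
    qed (auto simp: rate_def)
    also have "\<dots> \<le> minimax_risk n b q (\<lambda>k l. \<alpha> * real k) (row_noise n (\<alpha> * real k / 2) (p k))"
      using minimax_risk_swap[OF q(1) p h(1) k(1,2), of b k \<alpha>] b by simp
    finally show ?thesis
      by blast
  qed
  then obtain k where "exp (- 2) / 13824 * rate n q 0 s
      \<le> minimax_risk n b q (\<lambda>k l. \<alpha> * real k) (row_noise n (\<alpha> * real k / 2) (p k))"
    by blast
  moreover have "noise_condition n \<sigma> (row_noise n (\<alpha> * real k / 2) (p k))"
    using model_conditions(1)[OF n M \<sigma>, of \<beta> k] by (simp only: \<alpha>_def s_def p_def)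
  moreover have "signal_condition n b \<beta> (\<lambda>k l. \<alpha> * real k)"
    "upper_signal_condition n b M \<beta> (\<lambda>k l. \<alpha> * real k)"
    using model_conditions(2,3)[OF n M \<sigma>] by (simp_all only: \<alpha>_def)
  ultimately show ?thesis
    unfolding s_def
    by (intro exI[of _ "\<lambda>k l. \<alpha> * real k"]
        exI[of _ "row_noise n (\<alpha> * real k / 2) (p k)"] conjI noise_law_row_noise)
qed

theorem theorem2p3:
  fixes q M :: real and \<beta> \<sigma> c :: "nat \<Rightarrow> real"
  assumes q: "0 \<le> q" "q \<le> 2"
    and M: "M > 1"
    and \<sigma>: "\<And>n. n \<ge> 1 \<Longrightarrow> \<sigma> n > 0"
    and c: "\<And>n. n \<ge> 1 \<Longrightarrow> 1 \<le> c n" "c \<in> o(\<lambda>n. sqrt (real n))"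
  shows "\<exists>C>0. \<exists>\<eta> :: nat \<Rightarrow> real. \<eta> \<longlonglongrightarrow> 0 \<and>
    (\<forall>\<^sub>F n in sequentially. \<exists>(\<mu> :: nat \<Rightarrow> nat \<Rightarrow> real) (N :: (nat \<times> nat \<Rightarrow> real) measure).
       noise_law n N \<and>
       noise_condition n (\<sigma> n) N \<and>
       signal_condition n (c n) (\<beta> n) \<mu> \<and>
       upper_signal_condition n (c n) M (\<beta> n) \<mu> \<and>
       minimax_risk n (c n) q \<mu> N \<ge> C * rate n q (\<eta> n) (snr n (\<beta> n) (\<sigma> n)))"
proof (intro exI[of _ "exp (- 2) / 13824"] exI[of _ "\<lambda>_. 0"] conjI)
  show "\<forall>\<^sub>F n in sequentially. \<exists>(\<mu> :: nat \<Rightarrow> nat \<Rightarrow> real) (N :: (nat \<times> nat \<Rightarrow> real) measure).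
       noise_law n N \<and>
       noise_condition n (\<sigma> n) N \<and>
       signal_condition n (c n) (\<beta> n) \<mu> \<and>
       upper_signal_condition n (c n) M (\<beta> n) \<mu> \<and>
       minimax_risk n (c n) q \<mu> N \<ge> exp (- 2) / 13824 * rate n q 0 (snr n (\<beta> n) (\<sigma> n))"
    using eventually_ge_at_top[of 2]
  proof eventually_elim
    case (elim n)
    then show ?case
      using minimax_lower_bound[of n M "\<sigma> n" "c n" q "\<beta> n"] M \<sigma>[of n] c(1)[of n] q by simp
  qed
qed simp_all

end
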